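(* Let $a>0$, $V_1=(0,a)$, $V_2=(a,0)$ and $P(t)=a(\cos t,\sin t)$, $t\in[0,2\pi)$. The loci of the Brocard points $\Omega_1(t)$ and $\Omega_2(t)$ of the triangle $V_1V_2P(t)$ are a pair of (skewed teardrop-shaped) closed curves that are inversely identical, i.e. one is the image of the other under an orientation-reversing isometry of the plane. They are given by the equations $$\Omega_1(t)=a\left[\frac{\sin^2 t+\cos t-\sin t}{(\sin t-2)\cos t-2\sin t+3},\ \frac{1-\cos t}{(\sin t-2)\cos t-2\sin t+3}\right],$$ $$\Omega_2(t)=a\left[\frac{1-\sin t}{(\cos t-2)\sin t-2\cos t+3},\ \frac{\cos^2 t-\cos t+\sin t}{(\sin t-2)\cos t-2\sin t+3}\right].$$
   Context: Brocard points: for the triangle with vertices $V_1,V_2,P$, here $\Omega_1$ denotes the unique interior point with $\angle\Omega_1V_2V_1=\angle\Omega_1V_1P=\angle\Omega_1PV_2$, and $\Omega_2$ the unique interior point with $\angle\Omega_2V_1V_2=\angle\Omega_2V_2P=\angle\Omega_2PV_1$. The names are assigned by the vertex labels and kept fixed as $P(t)$ moves. At the finitely many values of $t$ for which the triangle is degenerate, the Brocard points are understood as limits. "Teardrop" is a descriptive term for the shape of the curves (closed, with one pointed end). *)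

theory Defs
  imports "HOL-Analysis.Analysis"
begin

text \<open>Unoriented angle at the vertex \<open>B\<close>, in \<open>[0, \<pi>]\<close> (meaningful for \<open>A \<noteq> B \<noteq> C\<close>).\<close>

definition angle :: "real^2 \<Rightarrow> real^2 \<Rightarrow> real^2 \<Rightarrow> real" where
  "angle A B C = arccos (inner (A - B) (C - B) / (norm (A - B) * norm (C - B)))"

definition is_brocard1 :: "real^2 \<Rightarrow> real^2 \<Rightarrow> real^2 \<Rightarrow> real^2 \<Rightarrow> bool" where
  "is_brocard1 A B C X \<longleftrightarrow> X \<in> interior (convex hull {A, B, C}) \<and>
     angle X B A = angle X A C \<and> angle X A C = angle X C B"

definition is_brocard2 :: "real^2 \<Rightarrow> real^2 \<Rightarrow> real^2 \<Rightarrow> real^2 \<Rightarrow> bool" where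
  "is_brocard2 A B C X \<longleftrightarrow> X \<in> interior (convex hull {A, B, C}) \<and>
     angle X A B = angle X B C \<and> angle X B C = angle X C A"

definition brocard1 :: "real^2 \<Rightarrow> real^2 \<Rightarrow> real^2 \<Rightarrow> real^2" where
  "brocard1 A B C = (THE X. is_brocard1 A B C X)"

definition brocard2 :: "real^2 \<Rightarrow> real^2 \<Rightarrow> real^2 \<Rightarrow> real^2" where
  "brocard2 A B C = (THE X. is_brocard2 A B C X)"

definition V1 :: "real \<Rightarrow> real^2" where
  "V1 a = vector [0, a]"

definition V2 :: "real \<Rightarrow> real^2" where
  "V2 a = vector [a, 0]"

definition P :: "real \<Rightarrow> real \<Rightarrow> real^2" where
  "P a t = a *\<^sub>R vector [cos t, sin t]"

definition degenerate :: "real \<Rightarrow> real \<Rightarrow> bool" where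
  "degenerate a t \<longleftrightarrow> collinear {V1 a, V2 a, P a t}"

text \<open>
  The parameter ranges over all reals, so the functions below have period \<open>2\<pi>\<close>, and the limit
  at \<open>t = 0\<close> is two-sided on the parameter circle.
\<close>

definition Omega1 :: "real \<Rightarrow> real \<Rightarrow> real^2" where
  "Omega1 a t =
     (if degenerate a t then Lim (at t) (\<lambda>s. brocard1 (V1 a) (V2 a) (P a s))
      else brocard1 (V1 a) (V2 a) (P a t))"

definition Omega2 :: "real \<Rightarrow> real \<Rightarrow> real^2" where
  "Omega2 a t =
     (if degenerate a t then Lim (at t) (\<lambda>s. brocard2 (V1 a) (V2 a) (P a s))
      else brocard2 (V1 a) (V2 a) (P a t))"

definition locus :: "(real \<Rightarrow> real^2) \<Rightarrow> (real^2) set" where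
  "locus \<gamma> = \<gamma> ` {0..<2*pi}"

text \<open>
  \<open>u\<close> and \<open>v\<close> are the directions of the two half-tangents at \<open>\<gamma> t\<close>, both pointing away from
  \<open>\<gamma> t\<close>. They are opposite where the curve is smooth, and equal at a cusp.
\<close>

definition pointed_at :: "(real \<Rightarrow> real^2) \<Rightarrow> real \<Rightarrow> bool" where
  "pointed_at \<gamma> t \<longleftrightarrow>
     (\<exists>u v. ((\<lambda>s. sgn (\<gamma> s - \<gamma> t)) \<longlongrightarrow> u) (at_left t) \<and>
            ((\<lambda>s. sgn (\<gamma> s - \<gamma> t)) \<longlongrightarrow> v) (at_right t) \<and> u \<noteq> - v)"

text \<open>
  A distance-preserving map of the plane is affine; \<open>\<lambda>x. f x - f 0\<close> is its linear part.
\<close>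

definition orientation_reversing_isometry :: "(real^2 \<Rightarrow> real^2) \<Rightarrow> bool" where
  "orientation_reversing_isometry f \<longleftrightarrow>
     (\<forall>x y. dist (f x) (f y) = dist x y) \<and> det (matrix (\<lambda>x. f x - f 0)) < 0"

end

theory Submission
  imports Defs
begin

text \<open>
  Let \<open>X = x A + y B + z C\<close> be an interior point of a triangle \<open>A B C\<close>, with positive barycentric
  coordinates. The cotangents of the three angles in \<open>is_brocard1\<close> are, up to the factor twice the
  area, \<open>x/z |AB|\<^sup>2\<close>, \<open>z/y |CA|\<^sup>2\<close> and \<open>y/x |BC|\<^sup>2\<close>, each plus the scalar product of the two sides
  at the vertex. By the law of cosines, equality of the angles says that these three quantities
  exceed \<open>|CA|\<^sup>2\<close>, \<open>|BC|\<^sup>2\<close>, \<open>|AB|\<^sup>2\<close> by one common amount; their product equals the product of the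
  squared sides, and a product of positive numbers is increasing in each factor, so the common
  amount is zero. This determines \<open>x : y : z = 1/|AB|\<^sup>2 : 1/|BC|\<^sup>2 : 1/|CA|\<^sup>2\<close>, which proves
  existence and uniqueness together (\<open>is_brocard1_iff\<close>). Exchanging the first two vertices turns
  the second Brocard point into the first one.

  For \<open>V1 V2 P(t)\<close> the squared sides are proportional to \<open>1\<close>, \<open>1 - cos t\<close> and \<open>1 - sin t\<close>, and
  substitution gives the two stated formulas, whose denominator
  \<open>((sin t + cos t - 2)\<^sup>2 + 1) / 2\<close> never vanishes. So the formulas are continuous everywhere, and they
  give the limits at the degenerate parameters, where \<open>cos t = 1\<close> or \<open>sin t = 1\<close>. The reflection
  in the line \<open>x = y\<close> exchanges \<open>V1\<close> and \<open>V2\<close> and maps \<open>P(t)\<close> to \<open>P(\<pi>/2 - t)\<close>, hence maps one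
  locus onto the other.

  The point of the first teardrop comes from the factorisation in \<open>curve1_minus_cusp\<close>: near a zero of
  \<open>1 - cos t\<close> the displacement is this nonnegative factor times a nonvanishing vector, so both
  half-tangents have the same direction, that of \<open>(-1, 1)\<close>. At all other parameters the velocity is nonzero
  (\<open>curve1_regular\<close>), and the half-tangents are opposite (\<open>not_pointed_at_regular\<close>). The second
  curve inherits both facts through the reflection.
\<close>

section \<open>Angles and signed areas in the plane\<close>

definition cross2 :: "real^2 \<Rightarrow> real^2 \<Rightarrow> real" where
  "cross2 u v = u $ 1 * v $ 2 - u $ 2 * v $ 1"

lemma inner_vec2: "inner u v = u $ 1 * v $ 1 + u $ 2 * v $ 2" for u v :: "real^2"
  by (simp add: inner_vec_def sum_2)

lemma vec2_eq_iff: "u = v \<longleftrightarrow> u $ 1 = v $ 1 \<and> u $ 2 = v $ 2" for u v :: "real^2"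
  by (simp add: vec_eq_iff forall_2)

lemma collinear_iff_cross2: "collinear {A, B, C} \<longleftrightarrow> cross2 (B - A) (C - A) = 0"
proof -
  have "collinear {A, B, C} \<longleftrightarrow> collinear {0, B - A, C - A}"
    using collinear_3[of B A C] by (simp add: insert_commute)
  also have "\<dots> \<longleftrightarrow> cross2 (B - A) (C - A) = 0"
  proof -
    have "v = (v $ 1 / u $ 1) *\<^sub>R u" if "cross2 u v = 0" "u $ 1 \<noteq> 0" for u v
      using that by (simp add: vec2_eq_iff cross2_def field_simps)
    moreover have "v = (v $ 2 / u $ 2) *\<^sub>R u" if "cross2 u v = 0" "u $ 2 \<noteq> 0" for u v
      using that by (simp add: vec2_eq_iff cross2_def field_simps)
    ultimately have "u = 0 \<or> (\<exists>c. v = c *\<^sub>R u)" if "cross2 u v = 0" for u v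
      using that by (metis vec2_eq_iff zero_index)
    moreover have "cross2 u v = 0" if "u = 0 \<or> v = 0 \<or> (\<exists>c. v = c *\<^sub>R u)" for u v
      using that by (auto simp: cross2_def)
    ultimately show ?thesis
      unfolding collinear_lemma by blast
  qed
  finally show ?thesis .
qed

text \<open>
  The angle is the arc cotangent of scalar product over area. In this form equal angles can be
  compared through the injectivity of \<open>arctan\<close>, and no square roots remain.
\<close>

lemma angle_eq_arctan:
  assumes "cross2 (A - B) (C - B) \<noteq> 0"
  shows "angle A B C = pi / 2 - arctan (inner (A - B) (C - B) / \<bar>cross2 (A - B) (C - B)\<bar>)"
proof -
  define u v where "u = A - B" and "v = C - B"
  define i k where "i = inner u v" and "k = \<bar>cross2 u v\<bar>"
  have "k > 0" using assms by (simp add: k_def u_def v_def)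
  have "(norm u * norm v)\<^sup>2 = i\<^sup>2 + k\<^sup>2"
    unfolding power_mult_distrib power2_norm_eq_inner i_def k_def power2_abs inner_vec2 cross2_def
    by (simp add: power2_eq_square algebra_simps)
  then have nn: "norm u * norm v = sqrt (i\<^sup>2 + k\<^sup>2)"
    by (metis mult_nonneg_nonneg norm_ge_zero real_sqrt_unique)
  have "i / (norm u * norm v) = (i / k) / sqrt (1 + (i / k)\<^sup>2)"
  proof -
    have "sqrt (i\<^sup>2 + k\<^sup>2) = k * sqrt (1 + (i / k)\<^sup>2)"
    proof -
      have "i\<^sup>2 + k\<^sup>2 = k\<^sup>2 * (1 + (i / k)\<^sup>2)"
        using \<open>k > 0\<close> by (simp add: field_simps)
      then show ?thesis using \<open>k > 0\<close> by (simp add: real_sqrt_mult)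
    qed
    then show ?thesis by (simp add: nn)
  qed
  also have "\<dots> = cos (pi / 2 - arctan (i / k))"
    by (simp add: cos_diff sin_arctan)
  finally have "angle A B C = arccos (cos (pi / 2 - arctan (i / k)))"
    by (simp add: angle_def i_def u_def v_def)
  also have "\<dots> = pi / 2 - arctan (i / k)"
    using arctan_bounded[of "i / k"] by (intro arccos_cos) auto
  finally show ?thesis by (simp add: i_def k_def u_def v_def)
qed

section \<open>The Brocard point of a triangle\<close>

text \<open>
  If the common difference were positive, all three factors on the left would be larger than
  those on the right, and so would the product; likewise for a negative difference.
\<close>

lemma shifted_product_unique:
  fixes p q r a b c :: real
  assumes pos: "p > 0" "q > 0" "r > 0" "a > 0" "b > 0" "c > 0"
    and "p * q * r = a * b * c" and "p - a = q - b" and "q - b = r - c"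
  shows "p = a"
proof (rule linorder_cases)
  assume "p < a"
  then have "q < b" "r < c" using assms by auto
  then have "p * q * r < a * b * c" using pos \<open>p < a\<close>
    by (intro mult_strict_mono) auto
  then show ?thesis using assms by simp
next
  assume "p > a"
  then have "q > b" "r > c" using assms by auto
  then have "p * q * r > a * b * c" using pos \<open>p > a\<close>
    by (intro mult_strict_mono) auto
  then show ?thesis using assms by simp
qed simp

text \<open>
  The triangle \<open>X B A\<close> has \<open>z\<close> times the area of \<open>A B C\<close>. The factor \<open>z\<close> cancels in the cotangent,
  which therefore depends only on the ratio \<open>x/z\<close>.
\<close>

lemma angle_barycentric:
  assumes "x > 0" "y > 0" "z > 0" "x + y + z = 1"
    and "cross2 (B - A) (C - A) \<noteq> 0"
  shows "angle (x *\<^sub>R A + y *\<^sub>R B + z *\<^sub>R C) B A =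
    pi / 2 - arctan ((x / z * inner (A - B) (A - B) + inner (A - B) (C - B)) / \<bar>cross2 (B - A) (C - A)\<bar>)"
proof -
  define X where "X = x *\<^sub>R A + y *\<^sub>R B + z *\<^sub>R C"
  define k where "k = cross2 (B - A) (C - A)"
  have y: "y = 1 - x - z" using assms by simp
  have "cross2 (X - B) (A - B) = z * k"
    unfolding X_def y k_def cross2_def by (simp add: algebra_simps)
  moreover have "inner (X - B) (A - B) = z * (x / z * inner (A - B) (A - B) + inner (A - B) (C - B))"
    using \<open>z > 0\<close> unfolding X_def y inner_vec2 by (simp add: field_simps)
  ultimately show ?thesis
    using assms angle_eq_arctan[of X B A] by (simp add: abs_mult X_def k_def)
qed

text \<open>
  The three angles arise from one another by cycling through \<open>(A, B, C)\<close>, \<open>(C, A, B)\<close> and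
  \<open>(B, C, A)\<close>. The weight ratios \<open>x/z\<close>, \<open>z/y\<close>, \<open>y/x\<close> have product one, which supplies the product
  condition that pins down the solution.
\<close>

lemma brocard_angles_iff:
  assumes pos: "x > 0" "y > 0" "z > 0" "x + y + z = 1"
    and nc: "cross2 (B - A) (C - A) \<noteq> 0"
  defines "X \<equiv> x *\<^sub>R A + y *\<^sub>R B + z *\<^sub>R C"
    and "a \<equiv> inner (B - C) (B - C)" and "b \<equiv> inner (C - A) (C - A)" and "c \<equiv> inner (A - B) (A - B)"
  shows "angle X B A = angle X A C \<and> angle X A C = angle X C B \<longleftrightarrow> x * c = z * b \<and> z * b = y * a"
proof -
  define k where "k = \<bar>cross2 (B - A) (C - A)\<bar>"
  have k: "k > 0" using nc by (simp add: k_def)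
  define p q r where "p = x / z * c" and "q = z / y * b" and "r = y / x * a"
  have cyc: "\<bar>cross2 (A - C) (B - C)\<bar> = k" "\<bar>cross2 (C - B) (A - B)\<bar> = k"
    by (auto simp: k_def cross2_def algebra_simps)
  then have cyc0: "cross2 (A - C) (B - C) \<noteq> 0" "cross2 (C - B) (A - B) \<noteq> 0"
    using k by auto
  have "a \<noteq> 0" "b \<noteq> 0" "c \<noteq> 0"
    using nc by (auto simp: a_def b_def c_def cross2_def)
  then have abc: "a > 0" "b > 0" "c > 0"
    unfolding a_def b_def c_def by (simp_all add: order_less_le)
  have a1: "angle X B A = pi / 2 - arctan ((p + inner (A - B) (C - B)) / k)"
    using angle_barycentric[OF pos nc] by (simp add: X_def p_def c_def k_def)
  have a2: "angle X A C = pi / 2 - arctan ((q + inner (C - A) (B - A)) / k)"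
    using angle_barycentric[of z x y A C B] pos nc cyc
    by (auto simp: X_def q_def b_def add_ac cross2_def k_def)
  have a3: "angle X C B = pi / 2 - arctan ((r + inner (B - C) (A - C)) / k)"
    using angle_barycentric[of y z x C B A] pos cyc0 cyc
    by (auto simp: X_def r_def a_def add_ac)
  \<comment> \<open>law of cosines\<close>
  have dots: "inner (A - B) (C - B) = (a + c - b) / 2" "inner (C - A) (B - A) = (b + c - a) / 2"
    "inner (B - C) (A - C) = (a + b - c) / 2"
    unfolding a_def b_def c_def inner_vec2 by (simp_all add: field_simps)
  have "angle X B A = angle X A C \<and> angle X A C = angle X C B \<longleftrightarrow> p - b = q - a \<and> q - a = r - c"
    using k unfolding a1 a2 a3 dots by (auto simp: arctan_eq_iff field_simps)
  also have "\<dots> \<longleftrightarrow> p = b \<and> q = a \<and> r = c"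
  proof -
    have "p > 0" "q > 0" "r > 0" "p * q * r = b * a * c"
      using pos abc by (simp_all add: p_def q_def r_def field_simps)
    then show ?thesis
      using shifted_product_unique[of p q r b a c] abc by auto
  qed
  also have "\<dots> \<longleftrightarrow> x * c = z * b \<and> z * b = y * a"
    using pos by (auto simp: p_def q_def r_def field_simps)
  finally show ?thesis .
qed

text \<open>
  The weights \<open>1/c : 1/a : 1/b\<close> of the vertices, cleared of denominators so that the formula makes
  sense for degenerate triangles as well.
\<close>

definition brocard_point :: "real^2 \<Rightarrow> real^2 \<Rightarrow> real^2 \<Rightarrow> real^2" where
  "brocard_point A B C =
    (let a = inner (B - C) (B - C); b = inner (C - A) (C - A); c = inner (A - B) (A - B)
     in (1 / (a * b + b * c + c * a)) *\<^sub>R ((a * b) *\<^sub>R A + (b * c) *\<^sub>R B + (c * a) *\<^sub>R C))"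

lemma is_brocard1_iff:
  assumes "\<not> collinear {A, B, C}"
  shows "is_brocard1 A B C X \<longleftrightarrow> X = brocard_point A B C"
proof -
  define a b c where "a = inner (B - C) (B - C)" and "b = inner (C - A) (C - A)"
    and "c = inner (A - B) (A - B)"
  define w where "w = a * b + b * c + c * a"
  have nc: "cross2 (B - A) (C - A) \<noteq> 0" using assms by (simp add: collinear_iff_cross2)
  then have "a \<noteq> 0" "b \<noteq> 0" "c \<noteq> 0"
    by (auto simp: a_def b_def c_def cross2_def)
  then have abc: "a > 0" "b > 0" "c > 0"
    unfolding a_def b_def c_def by (simp_all add: order_less_le)
  then have w: "w > 0" by (simp add: w_def add_pos_pos)
  have bp: "brocard_point A B C = (a * b / w) *\<^sub>R A + (b * c / w) *\<^sub>R B + (c * a / w) *\<^sub>R C"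
    by (simp add: brocard_point_def Let_def w_def a_def b_def c_def scaleR_add_right)
  have int: "interior (convex hull {A, B, C}) =
      {v. \<exists>x y z. 0 < x \<and> 0 < y \<and> 0 < z \<and> x + y + z = 1 \<and> x *\<^sub>R A + y *\<^sub>R B + z *\<^sub>R C = v}"
    using interior_convex_hull_3_minimal[OF assms] by simp
  show ?thesis
  proof
    assume X: "is_brocard1 A B C X"
    then obtain x y z where xyz: "0 < x" "0 < y" "0 < z" "x + y + z = 1"
      and X_eq: "X = x *\<^sub>R A + y *\<^sub>R B + z *\<^sub>R C"
      unfolding is_brocard1_def int by blast
    have eq: "x * c = z * b" "z * b = y * a"
      using X brocard_angles_iff[OF xyz nc] by (auto simp: is_brocard1_def X_eq a_def b_def c_def)
    \<comment> \<open>the common ratio between the given and the explicit weights\<close>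
    define l where "l = x * c / (a * b * c)"
    have l: "x = l * (a * b)" "y = l * (b * c)" "z = l * (c * a)"
      using eq abc by (simp_all add: l_def field_simps)
    have "l * w = 1"
      using xyz(4) unfolding w_def l by (simp add: algebra_simps)
    then have "l = 1 / w" using w by (simp add: field_simps)
    then show "X = brocard_point A B C"
      by (simp add: X_eq bp l)
  next
    assume X: "X = brocard_point A B C"
    have pos: "0 < a * b / w" "0 < b * c / w" "0 < c * a / w"
      using abc w by auto
    have one: "a * b / w + b * c / w + c * a / w = 1"
      using w by (simp add: w_def add_divide_distrib[symmetric])
    show "is_brocard1 A B C X"
      using brocard_angles_iff[OF pos one nc] pos one
      unfolding is_brocard1_def int X bp
      by (auto simp: a_def[symmetric] b_def[symmetric] c_def[symmetric] mult_ac) 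
  qed
qed

lemma is_brocard2_swap: "is_brocard2 A B C X \<longleftrightarrow> is_brocard1 B A C X"
  by (auto simp: is_brocard1_def is_brocard2_def insert_commute)


lemma brocard1_eq: "\<not> collinear {A, B, C} \<Longrightarrow> brocard1 A B C = brocard_point A B C"
  by (simp add: brocard1_def is_brocard1_iff)

lemma brocard2_eq: "\<not> collinear {A, B, C} \<Longrightarrow> brocard2 A B C = brocard_point B A C"
  using is_brocard1_iff[of B A C] by (simp add: brocard2_def is_brocard2_swap insert_commute)

section \<open>The two loci\<close>

definition den :: "real \<Rightarrow> real" where
  "den t = (sin t - 2) * cos t - 2 * sin t + 3"

definition curve1 :: "real \<Rightarrow> real \<Rightarrow> real^2" where
  "curve1 a t = a *\<^sub>R vector [((sin t)\<^sup>2 + cos t - sin t) / den t, (1 - cos t) / den t]"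

definition swap :: "real^2 \<Rightarrow> real^2" where
  "swap v = vector [v $ 2, v $ 1]"

text \<open>
  Defined as a mirror image, so that statements about the second locus follow from those about
  the first; \<open>curve2_eq\<close> recovers the explicit formula.
\<close>

definition curve2 :: "real \<Rightarrow> real \<Rightarrow> real^2" where
  "curve2 a t = swap (curve1 a (pi / 2 - t))"

lemma den_pos: "den t > 0"
proof -
  have "2 * den t = (sin t + cos t - 2)\<^sup>2 + 1"
    using sin_cos_squared_add[of t] unfolding den_def power2_eq_square by algebra
  then show ?thesis
    by (smt (verit) zero_le_power2)
qed

lemma den_reflect: "den (pi / 2 - t) = den t"
  by (simp add: den_def cos_diff sin_diff algebra_simps)

lemma curve2_eq:
  "curve2 a t = a *\<^sub>R vector [(1 - sin t) / den t, ((cos t)\<^sup>2 - cos t + sin t) / den t]"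
  by (simp add: curve2_def curve1_def swap_def den_reflect vec2_eq_iff cos_diff sin_diff algebra_simps)

text \<open>
  Collinearity means \<open>cos t + sin t = 1\<close>, and on the unit circle the square of
  \<open>1 - cos t - sin t\<close> factors as \<open>2 (1 - cos t) (1 - sin t)\<close>. So degeneracy is the vanishing of a
  side: \<open>P(t)\<close> meets \<open>V2\<close> or \<open>V1\<close>.
\<close>

lemma degenerate_iff:
  assumes "a > 0"
  shows "degenerate a t \<longleftrightarrow> cos t = 1 \<or> sin t = 1"
proof -
  have "degenerate a t \<longleftrightarrow> a * (a * (1 - cos t - sin t)) = 0"
    unfolding degenerate_def collinear_iff_cross2 cross2_def V1_def V2_def P_def
    by (simp add: algebra_simps) (metis add.commute)
  also have "\<dots> \<longleftrightarrow> (1 - cos t - sin t)\<^sup>2 = 0"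
    using assms by simp
  also have "(1 - cos t - sin t)\<^sup>2 = 2 * ((1 - cos t) * (1 - sin t))"
    using sin_cos_squared_add[of t] unfolding power2_eq_square by algebra
  finally show ?thesis by auto
qed

lemma squared_sides:
  "inner (V1 a - V2 a) (V1 a - V2 a) = 2 * a\<^sup>2"
  "inner (V2 a - V1 a) (V2 a - V1 a) = 2 * a\<^sup>2"
  "inner (V2 a - P a t) (V2 a - P a t) = 2 * a\<^sup>2 * (1 - cos t)"
  "inner (P a t - V2 a) (P a t - V2 a) = 2 * a\<^sup>2 * (1 - cos t)"
  "inner (V1 a - P a t) (V1 a - P a t) = 2 * a\<^sup>2 * (1 - sin t)"
  "inner (P a t - V1 a) (P a t - V1 a) = 2 * a\<^sup>2 * (1 - sin t)"
  using sin_cos_squared_add[of t]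
  unfolding inner_vec2 V1_def V2_def P_def power2_eq_square
  by (simp_all, algebra+)

text \<open>The formula is homogeneous in the squared sides, so the common factor \<open>2 a\<^sup>2\<close> can be dropped.\<close>

lemma brocard_point_proportional:
  assumes "k \<noteq> 0"
    and "inner (B - C) (B - C) = k * a" "inner (C - A) (C - A) = k * b" "inner (A - B) (A - B) = k * c"
  shows "brocard_point A B C =
    (1 / (a * b + b * c + c * a)) *\<^sub>R ((a * b) *\<^sub>R A + (b * c) *\<^sub>R B + (c * a) *\<^sub>R C)"
proof -
  have num: "(k * x * (k * y)) *\<^sub>R Z = k\<^sup>2 *\<^sub>R ((x * y) *\<^sub>R Z)" for x y and Z :: "real^2"
    by (simp add: power2_eq_square mult_ac)
  have den: "k * a * (k * b) + k * b * (k * c) + k * c * (k * a) = k\<^sup>2 * (a * b + b * c + c * a)"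
    by (simp add: power2_eq_square algebra_simps)
  show ?thesis
    unfolding brocard_point_def Let_def assms(2-4) num den scaleR_add_right[symmetric]
    using \<open>k \<noteq> 0\<close> by simp
qed

lemma brocard_point_eq_curve:
  assumes "a > 0"
  shows "brocard_point (V1 a) (V2 a) (P a t) = curve1 a t"
    and "brocard_point (V2 a) (V1 a) (P a t) = curve2 a t"
proof -
  define c s where "c = cos t" and "s = sin t"
  have cs: "s\<^sup>2 + c\<^sup>2 = 1" by (simp add: c_def s_def)
  have D: "(1 - c) * (1 - s) + (1 - s) * 1 + 1 * (1 - c) = den t"
    "(1 - s) * (1 - c) + (1 - c) * 1 + 1 * (1 - s) = den t"
    by (simp_all add: den_def c_def s_def algebra_simps)
  have k: "2 * a\<^sup>2 \<noteq> 0" using assms by simp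
  have x: "(1 - s) + (1 - c) * c = s\<^sup>2 + c - s" and y: "(1 - c) + (1 - s) * s = c\<^sup>2 - c + s"
    using cs by algebra+
  have "brocard_point (V1 a) (V2 a) (P a t) =
      (1 / den t) *\<^sub>R (((1 - c) * (1 - s)) *\<^sub>R V1 a + (1 - s) *\<^sub>R V2 a + (1 - c) *\<^sub>R P a t)"
    using brocard_point_proportional[OF k, of "V2 a" "P a t" "1 - c" "V1 a" "1 - s" 1]
    unfolding D by (simp add: squared_sides c_def s_def)
  also have "\<dots> = (a / den t) *\<^sub>R vector [(1 - s) + (1 - c) * c, 1 - c]"
    using den_pos[of t]
    by (simp add: V1_def V2_def P_def vec2_eq_iff c_def s_def field_simps)
  finally show "brocard_point (V1 a) (V2 a) (P a t) = curve1 a t"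
    unfolding x by (simp add: curve1_def vec2_eq_iff c_def s_def)
  have "brocard_point (V2 a) (V1 a) (P a t) =
      (1 / den t) *\<^sub>R (((1 - s) * (1 - c)) *\<^sub>R V2 a + (1 - c) *\<^sub>R V1 a + (1 - s) *\<^sub>R P a t)"
    using brocard_point_proportional[OF k, of "V1 a" "P a t" "1 - s" "V2 a" "1 - c" 1]
    unfolding D by (simp add: squared_sides c_def s_def)
  also have "\<dots> = (a / den t) *\<^sub>R vector [1 - s, (1 - c) + (1 - s) * s]"
    using den_pos[of t]
    by (simp add: V1_def V2_def P_def vec2_eq_iff c_def s_def field_simps)
  finally show "brocard_point (V2 a) (V1 a) (P a t) = curve2 a t"
    unfolding y by (simp add: curve2_eq vec2_eq_iff c_def s_def)
qed

section \<open>Limits at the degenerate parameters\<close>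

text \<open>
  With \<open>b = 0\<close> and \<open>b = \<pi>/2\<close> this isolates the zeros of \<open>1 - cos\<close> and of \<open>1 - sin\<close>.
\<close>

lemma eventually_cos_neq_1: "\<forall>\<^sub>F s in at t. cos (s - b) \<noteq> 1" for t b :: real
proof (cases "cos (t - b) = 1")
  case True
  have "cos (s - b) \<noteq> 1" if "s \<noteq> t" "dist s t < pi" for s
  proof -
    have "cos (s - b) = cos ((s - t) + (t - b))" by simp
    also have "\<dots> = cos (s - t)"
      using True cos_one_sin_zero[OF True] by (simp only: cos_add)
    also have "\<dots> = cos \<bar>s - t\<bar>" by simp
    also have "\<dots> < cos 0"
      using that by (intro cos_monotone_0_pi) (auto simp: dist_real_def)
    finally show ?thesis by simp
  qed
  then show ?thesis
    unfolding eventually_at using pi_gt_zero by blast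
next
  case False
  have "((\<lambda>s. cos (s - b)) \<longlongrightarrow> cos (t - b)) (at t)" by (intro tendsto_intros)
  then show ?thesis using False tendsto_imp_eventually_ne by blast
qed

lemma eventually_not_degenerate:
  assumes "a > 0"
  shows "\<forall>\<^sub>F s in at t. \<not> degenerate a s"
  using eventually_cos_neq_1[of 0 t] eventually_cos_neq_1[of "pi / 2" t]
  by eventually_elim (simp add: degenerate_iff[OF assms] cos_diff)

lemma cos_eq_1_iff_0:
  assumes "- 2 * pi < t" "t < 2 * pi"
  shows "cos t = 1 \<longleftrightarrow> t = 0"
proof
  assume "cos t = 1"
  then obtain n :: int where n: "t = of_int n * 2 * pi" using cos_one_2pi_int by auto
  then have "- 1 * (2 * pi) < of_int n * (2 * pi)" "of_int n * (2 * pi) < 1 * (2 * pi)" using assms by auto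
  then have "- 1 < real_of_int n" "real_of_int n < 1"
    using mult_right_less_imp_less[of "- 1" "2 * pi" "of_int n"]
      mult_right_less_imp_less[of "of_int n" "2 * pi" 1] by auto
  then show "t = 0" using n by simp
qed simp

lemma sin_eq_1_iff_pi_half:
  assumes "t \<in> {0..<2*pi}"
  shows "sin t = 1 \<longleftrightarrow> t = pi / 2"
  using cos_eq_1_iff_0[of "t - pi / 2"] assms by (simp add: cos_diff)

text \<open>
  With the standard basis written out, limits, continuity and derivatives of plane curves reduce
  to the rules for sums and scalar multiples.
\<close>

lemma vector_2_eq_axis: "vector [x, y] = x *\<^sub>R axis 1 1 + y *\<^sub>R (axis 2 1 :: real^2)"
  by (simp add: vec2_eq_iff axis_def)

lemma tendsto_vector_2:
  assumes "(f \<longlongrightarrow> x) F" "(g \<longlongrightarrow> y) F"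
  shows "((\<lambda>s. vector [f s, g s] :: real^2) \<longlongrightarrow> vector [x, y]) F"
  unfolding vector_2_eq_axis using assms by (intro tendsto_intros)

lemma bounded_linear_swap: "bounded_linear swap"
  by (intro linear_conv_bounded_linear[THEN iffD1] linearI) (simp_all add: swap_def vec2_eq_iff)

lemma continuous_curve1: "continuous_on UNIV (curve1 a)"
  using den_pos
  unfolding curve1_def vector_2_eq_axis den_def by (intro continuous_intros ballI) (metis less_irrefl)+

lemma continuous_curve2: "continuous_on UNIV (curve2 a)"
  unfolding curve2_def
  by (intro linear_continuous_on_compose[OF _ bounded_linear_swap[THEN bounded_linear.linear]]
      continuous_on_compose2[OF continuous_curve1] continuous_intros) auto

text \<open>
  Both cases of the definition of \<open>Omega1\<close> agree with the formula: off the degenerate parameters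
  by computation, and at them because the formula is continuous and the exceptions are isolated.
\<close>

lemma Omega1_eq: "a > 0 \<Longrightarrow> Omega1 a t = curve1 a t"
  and tendsto_brocard1: "a > 0 \<Longrightarrow> ((\<lambda>s. brocard1 (V1 a) (V2 a) (P a s)) \<longlongrightarrow> curve1 a t) (at t)"
proof -
  assume a: "a > 0"
  have eq: "brocard1 (V1 a) (V2 a) (P a s) = curve1 a s" if "\<not> degenerate a s" for s
    using that a by (simp add: degenerate_def brocard1_eq brocard_point_eq_curve)
  have "(curve1 a \<longlongrightarrow> curve1 a t) (at t)"
    using continuous_curve1[of a] by (simp add: continuous_on_def)
  then show lim: "((\<lambda>s. brocard1 (V1 a) (V2 a) (P a s)) \<longlongrightarrow> curve1 a t) (at t)"
    by (rule Lim_transform_eventually)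
      (rule eventually_mono[OF eventually_not_degenerate[OF a]], simp add: eq)
  show "Omega1 a t = curve1 a t"
    using eq tendsto_Lim[OF _ lim] by (simp add: Omega1_def)
qed

lemma Omega2_eq: "a > 0 \<Longrightarrow> Omega2 a t = curve2 a t"
  and tendsto_brocard2: "a > 0 \<Longrightarrow> ((\<lambda>s. brocard2 (V1 a) (V2 a) (P a s)) \<longlongrightarrow> curve2 a t) (at t)"
proof -
  assume a: "a > 0"
  have eq: "brocard2 (V1 a) (V2 a) (P a s) = curve2 a s" if "\<not> degenerate a s" for s
    using that a by (simp add: degenerate_def brocard2_eq brocard_point_eq_curve)
  have "(curve2 a \<longlongrightarrow> curve2 a t) (at t)"
    using continuous_curve2[of a] by (simp add: continuous_on_def)
  then show lim: "((\<lambda>s. brocard2 (V1 a) (V2 a) (P a s)) \<longlongrightarrow> curve2 a t) (at t)"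
    by (rule Lim_transform_eventually)
      (rule eventually_mono[OF eventually_not_degenerate[OF a]], simp add: eq)
  show "Omega2 a t = curve2 a t"
    using eq tendsto_Lim[OF _ lim] by (simp add: Omega2_def)
qed

section \<open>Half-tangents\<close>

text \<open>
  Dividing the displacement by a positive scalar does not change its direction, so both
  half-tangents point along \<open>d\<close>.
\<close>

lemma pointed_at_cusp:
  assumes "\<forall>\<^sub>F s in at t. k s > 0" and "\<And>s. \<gamma> s - \<gamma> t = k s *\<^sub>R w s"
    and "(w \<longlongrightarrow> d) (at t)" and "d \<noteq> 0"
  shows "pointed_at \<gamma> t"
proof -
  have "((\<lambda>s. sgn (w s)) \<longlongrightarrow> sgn d) (at t)"
    using assms by (intro tendsto_sgn)
  moreover have "\<forall>\<^sub>F s in at t. sgn (w s) = sgn (\<gamma> s - \<gamma> t)"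
    using assms(1) by eventually_elim (simp add: assms(2) sgn_scaleR)
  ultimately have "((\<lambda>s. sgn (\<gamma> s - \<gamma> t)) \<longlongrightarrow> sgn d) (at t)"
    by (rule Lim_transform_eventually)
  moreover have "sgn d \<noteq> - sgn d"
  proof
    assume "sgn d = - sgn d"
    then have "2 *\<^sub>R sgn d = 0" by (simp add: scaleR_2 eq_neg_iff_add_eq_0)
    then show False using \<open>d \<noteq> 0\<close> by (simp add: sgn_zero_iff)
  qed
  ultimately show ?thesis
    unfolding pointed_at_def filterlim_at_split by blast
qed

text \<open>
  The displacement is \<open>s - t\<close> times the difference quotient, and \<open>s - t\<close> changes sign at \<open>t\<close>. So the
  half-tangents are \<open>sgn d\<close> and \<open>- sgn d\<close>, and limits are unique.
\<close>

lemma not_pointed_at_regular: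
  assumes "(\<gamma> has_vector_derivative d) (at t)" and "d \<noteq> 0"
  shows "\<not> pointed_at \<gamma> t"
proof -
  define q where "q s = inverse (s - t) *\<^sub>R (\<gamma> s - \<gamma> t)" for s
  have q: "(q \<longlongrightarrow> d) (at t)"
  proof (rule vec_tendstoI)
    fix i
    have "((\<lambda>s. \<gamma> s $ i) has_real_derivative d $ i) (at t)"
      using bounded_linear.has_vector_derivative[OF bounded_linear_vec_nth assms(1)]
      by (simp add: has_real_derivative_iff_has_vector_derivative)
    then show "((\<lambda>s. q s $ i) \<longlongrightarrow> d $ i) (at t)"
      by (simp add: has_field_derivative_iff q_def divide_inverse mult.commute)
  qed
  have sgn_q: "((\<lambda>s. sgn (q s)) \<longlongrightarrow> sgn d) (at t)"
    using q assms(2) by (rule tendsto_sgn)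
  have R: "((\<lambda>s. sgn (\<gamma> s - \<gamma> t)) \<longlongrightarrow> sgn d) (at_right t)"
  proof (rule Lim_transform_eventually)
    show "((\<lambda>s. sgn (q s)) \<longlongrightarrow> sgn d) (at_right t)"
      using sgn_q by (simp add: filterlim_at_split)
    show "\<forall>\<^sub>F s in at_right t. sgn (q s) = sgn (\<gamma> s - \<gamma> t)"
      by (rule eventually_at_right_less[THEN eventually_mono]) (simp add: q_def sgn_scaleR)
  qed
  have L: "((\<lambda>s. sgn (\<gamma> s - \<gamma> t)) \<longlongrightarrow> - sgn d) (at_left t)"
  proof (rule Lim_transform_eventually)
    show "((\<lambda>s. - sgn (q s)) \<longlongrightarrow> - sgn d) (at_left t)"
      using sgn_q by (intro tendsto_minus) (simp add: filterlim_at_split)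
    show "\<forall>\<^sub>F s in at_left t. - sgn (q s) = sgn (\<gamma> s - \<gamma> t)"
      unfolding eventually_at_filter by (simp add: q_def sgn_scaleR)
  qed
  show ?thesis
    using tendsto_unique[OF _ L] tendsto_unique[OF _ R]
    unfolding pointed_at_def by (metis trivial_limit_at_left_real trivial_limit_at_right_real)
qed

text \<open>
  The numerators of the coordinates of the velocity of \<open>curve1 1\<close> over the denominator
  \<open>(den t)\<^sup>2\<close>; the second one is simplified by \<open>sin\<^sup>2 + cos\<^sup>2 = 1\<close>.
\<close>

definition deriv_numer_x :: "real \<Rightarrow> real" where
  "deriv_numer_x t = (2 * sin t * cos t - sin t - cos t) * den t
     - ((sin t)\<^sup>2 + cos t - sin t) * ((cos t - sin t) * (cos t + sin t - 2))"

definition deriv_numer_y :: "real \<Rightarrow> real" where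
  "deriv_numer_y t = sin t - (1 - cos t) * (1 - cos t + (cos t)\<^sup>2)"

lemma curve1_deriv:
  "(curve1 a has_vector_derivative ((a / (den t)\<^sup>2) *\<^sub>R vector [deriv_numer_x t, deriv_numer_y t])) (at t)"
proof -
  have d: "den t \<noteq> 0" using den_pos[of t] by simp
  have dd: "(den has_real_derivative (cos t - sin t) * (cos t + sin t - 2)) (at t)"
    unfolding den_def[abs_def]
    by (auto intro!: derivative_eq_intros simp: algebra_simps power2_eq_square)
  have x: "((\<lambda>t. ((sin t)\<^sup>2 + cos t - sin t) / den t) has_real_derivative deriv_numer_x t / (den t)\<^sup>2) (at t)"
    using d by (auto intro!: derivative_eq_intros dd simp: deriv_numer_x_def power2_eq_square algebra_simps)
  have y: "((\<lambda>t. (1 - cos t) / den t) has_real_derivative deriv_numer_y t / (den t)\<^sup>2) (at t)"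
  proof -
    have "sin t * den t - (1 - cos t) * ((cos t - sin t) * (cos t + sin t - 2)) = deriv_numer_y t"
      using sin_cos_squared_add[of t] unfolding deriv_numer_y_def den_def by algebra
    then show ?thesis
      using d by (auto intro!: derivative_eq_intros dd simp: power2_eq_square)
  qed
  have "(curve1 a has_vector_derivative a *\<^sub>R
      ((deriv_numer_x t / (den t)\<^sup>2) *\<^sub>R axis 1 1 + (deriv_numer_y t / (den t)\<^sup>2) *\<^sub>R axis 2 1)) (at t)"
    unfolding curve1_def[abs_def] vector_2_eq_axis
    by (intro bounded_linear.has_vector_derivative[OF bounded_linear_scaleR_right]
        bounded_linear.has_vector_derivative[OF bounded_linear_scaleR_left] has_vector_derivative_add
        x[unfolded has_real_derivative_iff_has_vector_derivative]
        y[unfolded has_real_derivative_iff_has_vector_derivative])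
  then show ?thesis
    by (simp add: vector_2_eq_axis scaleR_add_right)
qed

text \<open>
  If the second coordinate vanishes, squaring \<open>sin t = (1 - c) (1 - c + c\<^sup>2)\<close> with \<open>c = cos t\<close> and
  dividing by \<open>1 - c\<close> leaves \<open>c\<close> times a positive quartic. So \<open>c = 0\<close> and \<open>sin t = 1\<close>, and there the
  first coordinate is \<open>-1\<close>.
\<close>

lemma curve1_regular:
  assumes "cos t \<noteq> 1" 
  shows "deriv_numer_x t \<noteq> 0 \<or> deriv_numer_y t \<noteq> 0"
proof (rule ccontr)
  define c s where "c = cos t" and "s = sin t"
  have cs: "s\<^sup>2 = (1 - c) * (1 + c)"
    using sin_squared_eq[of t] by (simp add: c_def s_def power2_eq_square algebra_simps)
  assume "\<not> ?thesis"
  then have d1: "deriv_numer_x t = 0" and s: "s = (1 - c) * (1 - c + c\<^sup>2)"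
    by (auto simp: deriv_numer_y_def c_def s_def)
  have "(1 - c) * (c * (c^4 - 3*c^3 + 5*c^2 - 5*c + 4)) = 0"
    using cs unfolding s by algebra
  moreover have "c^4 - 3*c^3 + 5*c^2 - 5*c + 4 = (c\<^sup>2 - 3/2*c + 1)\<^sup>2 + 3/4 * (c - 4/3)\<^sup>2 + 5/3"
    by (simp add: power2_eq_square power3_eq_cube power4_eq_xxxx field_simps)
  then have "c^4 - 3*c^3 + 5*c^2 - 5*c + 4 > 0"
    by (smt (verit) zero_le_power2 divide_pos_pos mult_nonneg_nonneg)
  ultimately have "c = 0" using assms by (simp add: c_def)
  then have "cos t = 0" "sin t = 1" using s by (auto simp: c_def s_def)
  then show False using d1 by (simp add: deriv_numer_x_def den_def)
qed

text \<open>
  Both coordinates of the displacement from the cusp \<open>(a, 0)\<close> vanish to second order, through the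
  same factor \<open>1 - cos s\<close>.
\<close>

lemma curve1_minus_cusp:
  assumes "cos t = 1"
  shows "curve1 a s - curve1 a t = (a * (1 - cos s) / den s) *\<^sub>R vector [cos s + sin s - 2, 1]"
proof -
  have "(sin s)\<^sup>2 + cos s - sin s - den s = (1 - cos s) * (cos s + sin s - 2)"
    using sin_cos_squared_add[of s] unfolding den_def by algebra
  then have "((sin s)\<^sup>2 + cos s - sin s) / den s - 1 = (1 - cos s) * (cos s + sin s - 2) / den s"
    using den_pos[of s] by (simp add: field_simps)
  moreover have "curve1 a t = a *\<^sub>R vector [1, 0]"
    using assms cos_one_sin_zero[OF assms] by (simp add: curve1_def den_def)
  ultimately show ?thesis
    by (simp add: curve1_def vec2_eq_iff algebra_simps)
qed

lemma pointed_curve1: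
  assumes "a > 0"
  shows "pointed_at (curve1 a) t \<longleftrightarrow> cos t = 1"
proof
  assume "pointed_at (curve1 a) t"
  then have "(a / (den t)\<^sup>2) *\<^sub>R vector [deriv_numer_x t, deriv_numer_y t] = (0 :: real^2)"
    using not_pointed_at_regular[OF curve1_deriv] by blast
  then show "cos t = 1"
    using assms den_pos[of t] curve1_regular[of t] by (auto simp: vec2_eq_iff)
next
  assume t: "cos t = 1"
  show "pointed_at (curve1 a) t"
  proof (rule pointed_at_cusp)
    show "curve1 a s - curve1 a t = (a * (1 - cos s) / den s) *\<^sub>R vector [cos s + sin s - 2, 1]" for s
      by (rule curve1_minus_cusp[OF t])
    show "\<forall>\<^sub>F s in at t. 0 < a * (1 - cos s) / den s"
      using eventually_cos_neq_1[of 0 t]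
      by eventually_elim (use assms den_pos in \<open>simp add: order_less_le\<close>)
    show "((\<lambda>s. vector [cos s + sin s - 2, 1] :: real^2) \<longlongrightarrow> vector [cos t + sin t - 2, 1]) (at t)"
      by (intro tendsto_vector_2 tendsto_intros)
  qed (simp add: vec2_eq_iff)
qed

lemma pointed_curve2:
  assumes "a > 0"
  shows "pointed_at (curve2 a) t \<longleftrightarrow> sin t = 1"
proof
  define r where "r = pi / 2 - t"
  define d where "d = (a / (den r)\<^sup>2) *\<^sub>R (vector [deriv_numer_x r, deriv_numer_y r] :: real^2)"
  assume p: "pointed_at (curve2 a) t"
  have "((\<lambda>t. pi / 2 - t) has_vector_derivative -1) (at t)"
    by (auto intro!: derivative_eq_intros)
  from vector_diff_chain_at[OF this curve1_deriv[of a "pi / 2 - t"]]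
  have "((\<lambda>t. curve1 a (pi / 2 - t)) has_vector_derivative - d) (at t)"
    by (simp add: o_def d_def r_def)
  then have "(curve2 a has_vector_derivative swap (- d)) (at t)"
    unfolding curve2_def[abs_def]
    by (rule bounded_linear.has_vector_derivative[OF bounded_linear_swap])
  then have "swap (- d) = 0" using not_pointed_at_regular p by blast
  then have "cos r = 1"
    using assms den_pos[of r] curve1_regular[of r] by (auto simp: vec2_eq_iff swap_def d_def)
  then show "sin t = 1" by (simp add: r_def cos_diff)
next
  assume t: "sin t = 1"
  then have r: "cos (pi / 2 - t) = 1" by (simp add: cos_diff)
  have eq: "curve2 a s - curve2 a t = (a * (1 - sin s) / den s) *\<^sub>R vector [1, cos s + sin s - 2]" for s
    using curve1_minus_cusp[OF r, of a "pi / 2 - s"]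
    unfolding curve2_def vec2_eq_iff swap_def
    by (simp add: den_reflect cos_diff sin_diff add.commute)
  show "pointed_at (curve2 a) t"
  proof (rule pointed_at_cusp)
    show "curve2 a s - curve2 a t = (a * (1 - sin s) / den s) *\<^sub>R vector [1, cos s + sin s - 2]" for s
      by (rule eq)
    show "\<forall>\<^sub>F s in at t. 0 < a * (1 - sin s) / den s"
      using eventually_cos_neq_1[of "pi / 2" t]
      by eventually_elim (use assms den_pos in \<open>simp add: order_less_le cos_diff\<close>)
    show "((\<lambda>s. vector [1, cos s + sin s - 2] :: real^2) \<longlongrightarrow> vector [1, cos t + sin t - 2]) (at t)"
      by (intro tendsto_vector_2 tendsto_intros)
  qed (simp add: vec2_eq_iff)
qed

lemma swap_isometry: "orientation_reversing_isometry swap"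
proof -
  have "dist (swap x) (swap y) = dist x y" for x y
    by (simp add: dist_norm norm_eq_sqrt_inner inner_vec2 swap_def)
  moreover have "det (matrix (\<lambda>x. swap x - swap 0)) = -1"
    by (simp add: det_2 matrix_def swap_def axis_def)
  ultimately show ?thesis by (simp add: orientation_reversing_isometry_def)
qed

section \<open>Closed curves\<close>

text \<open>
  A function of \<open>cos t\<close> and \<open>sin t\<close> is a function on the circle, and each point of the circle has a
  parameter in \<open>[0, 2\<pi>)\<close>. Passing to the full range makes \<open>t \<mapsto> \<pi>/2 - t\<close> a bijection of the parameters.
\<close>

lemma image_periodic:
  fixes g :: "real \<Rightarrow> 'b"
  assumes "\<And>s t. cos s = cos t \<Longrightarrow> sin s = sin t \<Longrightarrow> g s = g t"
  shows "g ` {0..<2*pi} = range g" "g ` {0..2*pi} = range g"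
proof -
  have "g t \<in> g ` {0..<2*pi}" for t
  proof -
    obtain r where "0 \<le> r" "r < 2*pi" "cos t = cos r" "sin t = sin r"
      using sincos_total_2pi[of "cos t" "sin t"] by auto
    then show ?thesis using assms[of t r] by auto
  qed
  then show "g ` {0..<2*pi} = range g" "g ` {0..2*pi} = range g" by force+
qed

lemma curve_periodic:
  assumes "cos s = cos t" "sin s = sin t"
  shows "curve1 a s = curve1 a t" "curve2 a s = curve2 a t"
  using assms by (simp_all add: curve1_def curve2_eq den_def)

lemma closed_curve:
  assumes cont: "continuous_on UNIV \<gamma>"
    and per: "\<And>s t. cos s = cos t \<Longrightarrow> sin s = sin t \<Longrightarrow> \<gamma> s = \<gamma> t"
  shows "path (\<lambda>s. \<gamma> (2 * pi * s))"
    and "pathfinish (\<lambda>s. \<gamma> (2 * pi * s)) = pathstart (\<lambda>s. \<gamma> (2 * pi * s))"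
    and "path_image (\<lambda>s. \<gamma> (2 * pi * s)) = locus \<gamma>"
proof -
  show "path (\<lambda>s. \<gamma> (2 * pi * s))"
    unfolding path_def by (intro continuous_on_compose2[OF cont] continuous_intros) auto
  show "pathfinish (\<lambda>s. \<gamma> (2 * pi * s)) = pathstart (\<lambda>s. \<gamma> (2 * pi * s))"
    unfolding pathfinish_def pathstart_def by (rule per) simp_all
  have "(\<lambda>s. 2 * pi * s) ` {0..1} = {0..2*pi}"
    by (subst image_mult_atLeastAtMost) auto
  then have "path_image (\<lambda>s. \<gamma> (2 * pi * s)) = \<gamma> ` {0..2*pi}"
    unfolding path_image_def by (metis image_image)
  then show "path_image (\<lambda>s. \<gamma> (2 * pi * s)) = locus \<gamma>"
    using image_periodic[of \<gamma>, OF per] by (simp add: locus_def)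
qed

lemma swap_locus: "swap ` locus (curve1 a) = locus (curve2 a)"
proof -
  have "range (curve2 a) = swap ` range (\<lambda>t. curve1 a (pi / 2 - t))"
    by (simp add: curve2_def[abs_def] image_image)
  also have "range (\<lambda>t. curve1 a (pi / 2 - t)) = range (curve1 a)"
  proof -
    have "surj (\<lambda>t. pi / 2 - t)" by (rule surjI[of _ "\<lambda>t. pi / 2 - t"]) simp
    moreover have "range (\<lambda>t. curve1 a (pi / 2 - t)) = curve1 a ` range (\<lambda>t. pi / 2 - t)"
      by (simp only: image_image)
    ultimately show ?thesis by (simp only:)
  qed
  finally have "range (curve2 a) = swap ` range (curve1 a)" .
  moreover have "locus (curve1 a) = range (curve1 a)" "locus (curve2 a) = range (curve2 a)"
    unfolding locus_def by (rule image_periodic(1), rule curve_periodic; assumption)+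
  ultimately show ?thesis by simp
qed

theorem proposition2:
  fixes a :: real
  assumes "a > 0"
  shows
    "finite {t \<in> {0..<2*pi}. degenerate a t} \<and>
     (\<forall>t\<in>{0..<2*pi}. \<not> degenerate a t \<longrightarrow>
       (\<exists>!X. is_brocard1 (V1 a) (V2 a) (P a t) X) \<and>
       (\<exists>!X. is_brocard2 (V1 a) (V2 a) (P a t) X)) \<and>
     (\<forall>t\<in>{0..<2*pi}. degenerate a t \<longrightarrow>
       ((\<lambda>s. brocard1 (V1 a) (V2 a) (P a s)) \<longlongrightarrow> Omega1 a t) (at t) \<and>
       ((\<lambda>s. brocard2 (V1 a) (V2 a) (P a s)) \<longlongrightarrow> Omega2 a t) (at t)) \<and>
     (\<forall>\<Omega>\<in>{Omega1 a, Omega2 a}.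
       path (\<lambda>s. \<Omega> (2 * pi * s)) \<and>
       pathfinish (\<lambda>s. \<Omega> (2 * pi * s)) = pathstart (\<lambda>s. \<Omega> (2 * pi * s)) \<and>
       path_image (\<lambda>s. \<Omega> (2 * pi * s)) = locus \<Omega> \<and>
       (\<exists>!t. t \<in> {0..<2*pi} \<and> pointed_at \<Omega> t)) \<and>
     (\<exists>f. orientation_reversing_isometry f \<and> f ` locus (Omega1 a) = locus (Omega2 a)) \<and>
     (\<forall>t\<in>{0..<2*pi}. Omega1 a t =
       a *\<^sub>R vector [((sin t)\<^sup>2 + cos t - sin t) / ((sin t - 2) * cos t - 2 * sin t + 3),
                     (1 - cos t) / ((sin t - 2) * cos t - 2 * sin t + 3)]) \<and>
     (\<forall>t\<in>{0..<2*pi}. Omega2 a t =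
       a *\<^sub>R vector [(1 - sin t) / ((cos t - 2) * sin t - 2 * cos t + 3),
                     ((cos t)\<^sup>2 - cos t + sin t) / ((sin t - 2) * cos t - 2 * sin t + 3)])"
proof -
  have Omega: "Omega1 a = curve1 a" "Omega2 a = curve2 a"
    using Omega1_eq Omega2_eq assms by blast+
  have "{t \<in> {0..<2*pi}. degenerate a t} \<subseteq> {0, pi / 2}"
    using cos_eq_1_iff_0 sin_eq_1_iff_pi_half by (auto simp: degenerate_iff[OF assms])
  then have fin: "finite {t \<in> {0..<2*pi}. degenerate a t}"
    by (rule finite_subset) simp
  have exactly_one: "\<forall>t\<in>{0..<2*pi}. \<not> degenerate a t \<longrightarrow>
      (\<exists>!X. is_brocard1 (V1 a) (V2 a) (P a t) X) \<and>
      (\<exists>!X. is_brocard2 (V1 a) (V2 a) (P a t) X)"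
    using is_brocard1_iff[of "V1 a" "V2 a"] is_brocard1_iff[of "V2 a" "V1 a"]
    by (simp add: degenerate_def is_brocard2_swap insert_commute)
  have limits: "\<forall>t\<in>{0..<2*pi}. degenerate a t \<longrightarrow>
      ((\<lambda>s. brocard1 (V1 a) (V2 a) (P a s)) \<longlongrightarrow> curve1 a t) (at t) \<and>
      ((\<lambda>s. brocard2 (V1 a) (V2 a) (P a s)) \<longlongrightarrow> curve2 a t) (at t)"
    using tendsto_brocard1[OF assms] tendsto_brocard2[OF assms] by blast
  have "\<exists>!t. t \<in> {0..<2*pi} \<and> pointed_at (curve1 a) t"
    unfolding pointed_curve1[OF assms] by (rule ex1I[of _ 0]) (auto simp: cos_eq_1_iff_0)
  moreover have "\<exists>!t. t \<in> {0..<2*pi} \<and> pointed_at (curve2 a) t"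
    unfolding pointed_curve2[OF assms]
    by (rule ex1I[of _ "pi / 2"]) (auto simp: sin_eq_1_iff_pi_half)
  ultimately have teardrop: "\<forall>\<Omega>\<in>{curve1 a, curve2 a}.
      path (\<lambda>s. \<Omega> (2 * pi * s)) \<and>
      pathfinish (\<lambda>s. \<Omega> (2 * pi * s)) = pathstart (\<lambda>s. \<Omega> (2 * pi * s)) \<and>
      path_image (\<lambda>s. \<Omega> (2 * pi * s)) = locus \<Omega> \<and>
      (\<exists>!t. t \<in> {0..<2*pi} \<and> pointed_at \<Omega> t)"
    using closed_curve[OF continuous_curve1 curve_periodic(1), of a]
      closed_curve[OF continuous_curve2 curve_periodic(2), of a]
    by (simp only: ball_simps simp_thms)
  have congruent: "\<exists>f. orientation_reversing_isometry f \<and> f ` locus (curve1 a) = locus (curve2 a)"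
    using swap_isometry swap_locus by blast
  have equation1: "\<forall>t\<in>{0..<2*pi}. curve1 a t =
      a *\<^sub>R vector [((sin t)\<^sup>2 + cos t - sin t) / ((sin t - 2) * cos t - 2 * sin t + 3),
                    (1 - cos t) / ((sin t - 2) * cos t - 2 * sin t + 3)]"
    by (simp add: curve1_def den_def)
  have "(cos t - 2) * sin t - 2 * cos t + 3 = den t" for t
    by (simp add: den_def algebra_simps)
  then have equation2: "\<forall>t\<in>{0..<2*pi}. curve2 a t =
      a *\<^sub>R vector [(1 - sin t) / ((cos t - 2) * sin t - 2 * cos t + 3),
                    ((cos t)\<^sup>2 - cos t + sin t) / ((sin t - 2) * cos t - 2 * sin t + 3)]"
    by (simp add: curve2_eq den_def)
  show ?thesis
    unfolding Omega
    by (intro conjI) (fact fin exactly_one limits teardrop congruent equation1 equation2)+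
qed

end
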